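(* Let $\mathcal{X}$ be a real normed linear space, $\varphi_1,\ldots,\varphi_n\in\mathcal{X}^*$, $\xi\in\mathbb{R}^n$, and let $w_1,\ldots,w_n>0$. Let $\psi_1,\ldots,\psi_k$, $h_1,\ldots,h_k$, $\mathcal{X}_0$, $\mathbf{A}$, $\mathbf{v}$ be as defined in the context. Let $\mathbf{u}^\dagger=(\alpha_1,\ldots,\alpha_k)\in\mathbb{R}^k$ be the unique solution of $\mathbf{A}\mathbf{u}=\mathbf{v}$, and, for $\lambda>0$, let $\mathbf{u}_\lambda=(\gamma_1,\ldots,\gamma_k)\in\mathbb{R}^k$ be the unique solution of $(\mathbf{A}+\lambda\mathbf{I})\mathbf{u}_\lambda=\mathbf{v}$. Let $f^\dagger=\sum_{j=1}^k\alpha_jh_j$, which is the unique element of $\mathcal{X}_0$ satisfying $\Phi^*\Phi(f^\dagger)=\Phi^*(\xi)$, and let $f_\lambda=\sum_{j=1}^k\gamma_jh_j$. Let $\mathbf{w}\in\mathbb{R}^k$ be the unique vector with $\mathbf{u}^\dagger=\mathbf{A}\mathbf{w}$. Then the inequalities $$\|\mathbf{u}^\dagger-\mathbf{u}_\lambda\|_{\mathbb{R}^k}\le\lambda\|\mathbf{w}\|_{\mathbb{R}^k},\qquad \|f^\dagger-f_\lambda\|_{\mathcal{X}}\le\Big(\sum_{j=1}^k\|h_j\|_{\mathcal{X}}^2\Big)^{1/2}\|\mathbf{u}^\dagger-\mathbf{u}_\lambda\|_{\mathbb{R}^k}$$ hold for every $\lambda>0$. In particular, $$\|\mathbf{u}^\dagger-\mathbf{u}_\lambda\|_{\mathbb{R}^k}=O(\lambda),\qquad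 \|f^\dagger-f_\lambda\|_{\mathcal{X}}=O(\lambda)\quad\text{as }\lambda\to0.$$
   Context: $\mathcal{X}^*$ is the space of continuous linear functionals on $\mathcal{X}$, and $\Phi:\mathcal{X}\to\mathbb{R}^n$ is $\Phi(f)=(\varphi_1(f),\ldots,\varphi_n(f))$. $\mathbb{R}^n$ carries the weighted inner product $\langle\mathbf{u},\mathbf{v}\rangle_{\mathbb{R}^n}=\sum_{i=1}^nw_i\mathbf{u}_i\mathbf{v}_i$, and $\Phi^*:\mathbb{R}^n\to\mathcal{X}^*$ is defined by $(\Phi^*(\mathbf{u}))(f)=\langle\Phi(f),\mathbf{u}\rangle_{\mathbb{R}^n}$. The functionals $\psi_1,\ldots,\psi_k\in\mathcal{X}^*$ are linearly independent with $\mathrm{span}\{\psi_1,\ldots,\psi_k\}=\mathrm{span}\{\varphi_1,\ldots,\varphi_n\}$; $h_1,\ldots,h_k\in\mathcal{X}$ satisfy $\psi_i(h_j)=\delta_{ij}$ for $i,j\in\{1,\ldots,k\}$; $\mathcal{X}_0=\mathrm{span}\{h_1,\ldots,h_k\}$. $\mathbf{A}=(a_{\ell j})$ is the $k\times k$ real matrix with $a_{\ell j}=\sum_{i=1}^nw_i\varphi_i(h_j)\varphi_i(h_\ell)$, and $\mathbf{v}=(\beta_1,\ldots,\beta_k)\in\mathbb{R}^k$ with $\beta_\ell=\sum_{i=1}^nw_i\xi_i\varphi_i(h_\ell)$. The matrix $\mathbf{A}$ is symmetric positive definite, hence $\mathbf{A}$ and $\mathbf{A}+\lambda\mathbf{I}$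 ($\lambda>0$, $\mathbf{I}$ the $k\times k$ identity) are invertible. $\|\cdot\|_{\mathbb{R}^k}$ is the standard Euclidean norm on $\mathbb{R}^k$. *)

theory Defs
  imports "HOL-Analysis.Analysis" "HOL-Library.Landau_Symbols"
begin

text \<open>
  The dual space is \<open>'a \<Rightarrow>\<^sub>L real\<close>. The finite index types \<open>'n\<close> and \<open>'k\<close>
  stand for \<open>{1..n}\<close> and \<open>{1..k}\<close>. The weights are called \<open>wt\<close>.
\<close>

definition winner :: "('n::finite \<Rightarrow> real) \<Rightarrow> real ^ 'n \<Rightarrow> real ^ 'n \<Rightarrow> real" where
  "winner wt u v = (\<Sum>i\<in>UNIV. wt i * u $ i * v $ i)"

definition Phi :: "('n::finite \<Rightarrow> 'a::real_normed_vector \<Rightarrow>\<^sub>L real) \<Rightarrow> 'a \<Rightarrow> real ^ 'n" where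
  "Phi \<phi> f = (\<chi> i. blinfun_apply (\<phi> i) f)"

definition Phi_adj ::
  "('n::finite \<Rightarrow> real) \<Rightarrow> ('n \<Rightarrow> 'a::real_normed_vector \<Rightarrow>\<^sub>L real) \<Rightarrow> real ^ 'n \<Rightarrow> 'a \<Rightarrow>\<^sub>L real" where
  "Phi_adj wt \<phi> u = Blinfun (\<lambda>f. winner wt (Phi \<phi> f) u)"

text \<open>The argument of \<^const>\<open>Blinfun\<close> is bounded linear, so its value is not arbitrary:\<close>

lemma blinfun_apply_Phi_adj:
  "blinfun_apply (Phi_adj wt \<phi> u) f = winner wt (Phi \<phi> f) u"
proof -
  have "bounded_linear (\<lambda>f. winner wt (Phi \<phi> f) u)"
    unfolding winner_def Phi_def vec_lambda_beta
    by (intro bounded_linear_sum bounded_linear_mult_const bounded_linear_const_mult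
        blinfun.bounded_linear_right)
  then show ?thesis
    unfolding Phi_adj_def by (simp add: bounded_linear_Blinfun_apply)
qed

definition gram_matrix ::
  "('n::finite \<Rightarrow> real) \<Rightarrow> ('n \<Rightarrow> 'a::real_normed_vector \<Rightarrow>\<^sub>L real) \<Rightarrow> ('k::finite \<Rightarrow> 'a) \<Rightarrow> real ^ 'k ^ 'k" where
  "gram_matrix wt \<phi> h =
     (\<chi> l j. \<Sum>i\<in>UNIV. wt i * blinfun_apply (\<phi> i) (h j) * blinfun_apply (\<phi> i) (h l))"

definition data_vector ::
  "('n::finite \<Rightarrow> real) \<Rightarrow> ('n \<Rightarrow> 'a::real_normed_vector \<Rightarrow>\<^sub>L real) \<Rightarrow> real ^ 'n \<Rightarrow> ('k::finite \<Rightarrow> 'a) \<Rightarrow> real ^ 'k" where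
  "data_vector wt \<phi> \<xi> h =
     (\<chi> l. \<Sum>i\<in>UNIV. wt i * \<xi> $ i * blinfun_apply (\<phi> i) (h l))"

definition u_dagger ::
  "('n::finite \<Rightarrow> real) \<Rightarrow> ('n \<Rightarrow> 'a::real_normed_vector \<Rightarrow>\<^sub>L real) \<Rightarrow> real ^ 'n \<Rightarrow> ('k::finite \<Rightarrow> 'a) \<Rightarrow> real ^ 'k" where
  "u_dagger wt \<phi> \<xi> h = (THE u. gram_matrix wt \<phi> h *v u = data_vector wt \<phi> \<xi> h)"

definition u_reg ::
  "('n::finite \<Rightarrow> real) \<Rightarrow> ('n \<Rightarrow> 'a::real_normed_vector \<Rightarrow>\<^sub>L real) \<Rightarrow> real ^ 'n \<Rightarrow> ('k::finite \<Rightarrow> 'a)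
    \<Rightarrow> real \<Rightarrow> real ^ 'k" where
  "u_reg wt \<phi> \<xi> h lam =
     (THE u. (gram_matrix wt \<phi> h + lam *\<^sub>R mat 1) *v u = data_vector wt \<phi> \<xi> h)"

definition w_source ::
  "('n::finite \<Rightarrow> real) \<Rightarrow> ('n \<Rightarrow> 'a::real_normed_vector \<Rightarrow>\<^sub>L real) \<Rightarrow> real ^ 'n \<Rightarrow> ('k::finite \<Rightarrow> 'a) \<Rightarrow> real ^ 'k" where
  "w_source wt \<phi> \<xi> h = (THE w. u_dagger wt \<phi> \<xi> h = gram_matrix wt \<phi> h *v w)"

definition f_dagger ::
  "('n::finite \<Rightarrow> real) \<Rightarrow> ('n \<Rightarrow> 'a::real_normed_vector \<Rightarrow>\<^sub>L real) \<Rightarrow> real ^ 'n \<Rightarrow> ('k::finite \<Rightarrow> 'a) \<Rightarrow> 'a" where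
  "f_dagger wt \<phi> \<xi> h = (\<Sum>j\<in>UNIV. u_dagger wt \<phi> \<xi> h $ j *\<^sub>R h j)"

definition f_reg ::
  "('n::finite \<Rightarrow> real) \<Rightarrow> ('n \<Rightarrow> 'a::real_normed_vector \<Rightarrow>\<^sub>L real) \<Rightarrow> real ^ 'n \<Rightarrow> ('k::finite \<Rightarrow> 'a)
    \<Rightarrow> real \<Rightarrow> 'a" where
  "f_reg wt \<phi> \<xi> h lam = (\<Sum>j\<in>UNIV. u_reg wt \<phi> \<xi> h lam $ j *\<^sub>R h j)"

end

theory Submission
  imports Defs
begin

text \<open>
  The functionals \<open>\<phi> i\<close> and \<open>\<psi> j\<close> span the same space, so they have the same common kernel.
  Biorthogonality therefore makes the coefficient vector of a combination of the \<open>h j\<close>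
  recoverable from its image under \<open>Phi \<phi>\<close>, and \<open>Phi \<phi>\<close> already takes all its values on the
  span of the \<open>h j\<close>. The Gram matrix \<open>A\<close> represents the pulled-back weighted inner product
  in these coefficients. Injectivity makes it positive definite, which gives every unique
  solvability claim. Because no value of \<open>Phi \<phi>\<close> is missed on the span, the normal equation
  need only be tested on the \<open>h l\<close>, and this turns it into \<open>A u = v\<close>.

  For the error estimate, put \<open>e = u\<^sub>\<dagger> - u\<^sub>\<lambda>\<close> with \<open>u\<^sub>\<dagger> = A w\<close>. Subtracting the two linear
  systems gives \<open>A (\<lambda> w - e) = \<lambda> e\<close>. Testing this against \<open>\<lambda> w - e\<close> and using positivity of
  \<open>A\<close> gives \<open>e \<bullet> e \<le> \<lambda> (w \<bullet> e)\<close>, from which Cauchy-Schwarz yields \<open>norm e \<le> \<lambda> * norm w\<close>.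
  This is \<open>norm_regularization_error_le\<close>. A second use of
  Cauchy-Schwarz transfers the bound from coefficients to \<open>f\<close>.
\<close>

section \<open>Regularization of positive definite systems\<close>

text \<open>In finite dimension injectivity, which is immediate from positivity, implies bijectivity.\<close>

lemma positive_definite_ex1_solution:
  fixes A :: "real ^ 'k ^ 'k"
  assumes pos: "\<And>x. x \<noteq> 0 \<Longrightarrow> 0 < x \<bullet> (A *v x)"
  shows "\<exists>!x. A *v x = b"
proof -
  have inj: "inj ((*v) A)"
  proof (rule injI)
    fix x y assume "A *v x = A *v y"
    then have "A *v (x - y) = 0"
      by (simp add: matrix_vector_mult_diff_distrib)
    then show "x = y"
      using pos[of "x - y"] by fastforce
  qed
  moreover have "surj ((*v) A)"
    using inj matrix_vector_mul_linear linear_injective_imp_surjective by blast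
  ultimately show ?thesis
    by (metis injD surjD)
qed

lemma regularized_mult:
  fixes A :: "real ^ 'k ^ 'k"
  shows "(A + lam *\<^sub>R mat 1) *v x = A *v x + lam *\<^sub>R x"
  by (simp add: matrix_vector_mult_add_rdistrib scaleR_matrix_vector_assoc[symmetric])

text \<open>The error \<open>e\<close> satisfies \<open>(A + lam) e = lam A w\<close>. The spectral argument would bound
  \<open>(A + lam)\<inverse> A\<close> by \<open>1\<close>. Here a single test vector does the same, and only the quadratic form of
  \<open>A\<close> has to be nonnegative.\<close>

lemma norm_regularization_error_le:
  fixes A :: "real ^ 'k ^ 'k"
  assumes psd: "\<And>x. 0 \<le> x \<bullet> (A *v x)"
    and lam: "lam > 0"
    and reg: "(A + lam *\<^sub>R mat 1) *v u = A *v (A *v w)"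
  shows "norm (A *v w - u) \<le> lam * norm w"
proof -
  define e where "e = A *v w - u"
  have "A *v (lam *\<^sub>R w - e) = lam *\<^sub>R e"
    using reg unfolding e_def regularized_mult
    by (simp add: matrix_vector_mult_diff_distrib matrix_vector_mult_scaleR algebra_simps)
  \<comment> \<open>The test vector is a preimage under \<open>A\<close> of \<open>lam e\<close>, so its quadratic form involves no \<open>A\<close>.\<close>
  then have "0 \<le> lam * ((lam *\<^sub>R w - e) \<bullet> e)"
    using psd[of "lam *\<^sub>R w - e"] by simp
  then have "e \<bullet> e \<le> lam * (w \<bullet> e)"
    using lam by (simp add: zero_le_mult_iff inner_diff_left)
  also have "\<dots> \<le> lam * (norm w * norm e)"
    using lam norm_cauchy_schwarz[of w e] by simp
  finally have "norm e * norm e \<le> (lam * norm w) * norm e"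
    by (simp add: dot_square_norm power2_eq_square mult.assoc)
  then have "norm e \<le> lam * norm w"
    using lam by (cases "e = 0") auto
  then show ?thesis by (simp add: e_def)
qed

section \<open>Linear combinations of the basis vectors\<close>

definition lincomb :: "('k::finite \<Rightarrow> 'a::real_normed_vector) \<Rightarrow> real ^ 'k \<Rightarrow> 'a" where
  "lincomb h u = (\<Sum>j\<in>UNIV. u $ j *\<^sub>R h j)"

lemma lincomb_diff: "lincomb h (u - v) = lincomb h u - lincomb h v"
  by (simp add: lincomb_def scaleR_diff_left sum_subtractf)

lemma span_range_eq_lincomb: "span (range h) = range (lincomb h)"
proof
  show "range (lincomb h) \<subseteq> span (range h)"
    unfolding lincomb_def by (auto intro!: span_sum span_scale intro: span_base)
  have "subspace (range (lincomb h))"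
  proof (rule subspaceI)
    show "0 \<in> range (lincomb h)"
      by (rule range_eqI[of _ _ 0]) (simp add: lincomb_def)
  next
    fix x y assume "x \<in> range (lincomb h)" "y \<in> range (lincomb h)"
    then obtain u v where "x = lincomb h u" "y = lincomb h v" by auto
    then show "x + y \<in> range (lincomb h)"
      by (intro range_eqI[of _ _ "u + v"])
        (simp add: lincomb_def scaleR_add_left sum.distrib)
  next
    fix c x assume "x \<in> range (lincomb h)"
    then obtain u where "x = lincomb h u" by auto
    then show "c *\<^sub>R x \<in> range (lincomb h)"
      by (intro range_eqI[of _ _ "c *\<^sub>R u"]) (simp add: lincomb_def scaleR_sum_right)
  qed
  moreover have "h j = lincomb h (axis j 1)" for j
    by (simp add: lincomb_def axis_def if_distrib[of "\<lambda>c. c *\<^sub>R _"] cong: if_cong)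
  then have "range h \<subseteq> range (lincomb h)" by blast
  ultimately show "span (range h) \<subseteq> range (lincomb h)"
    by (intro span_minimal)
qed

lemma norm_lincomb_le:
  "norm (lincomb h u) \<le> sqrt (\<Sum>j\<in>UNIV. (norm (h j))\<^sup>2) * norm u"
proof -
  have "norm (lincomb h u) \<le> (\<Sum>j\<in>UNIV. \<bar>norm (h j)\<bar> * \<bar>u $ j\<bar>)"
    unfolding lincomb_def by (rule order.trans[OF norm_sum]) (simp add: mult.commute)
  also have "\<dots> \<le> L2_set (\<lambda>j. norm (h j)) UNIV * L2_set (\<lambda>j. u $ j) UNIV"
    by (rule L2_set_mult_ineq)
  finally show ?thesis
    by (simp add: L2_set_def norm_vec_def)
qed

section \<open>The Gram system\<close>

lemma winner_commute: "winner wt x y = winner wt y x"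
  by (simp add: winner_def mult_ac)

lemma Phi_lincomb: "Phi \<phi> (lincomb h u) = (\<Sum>j\<in>UNIV. u $ j *\<^sub>R Phi \<phi> (h j))"
  by (simp add: Phi_def lincomb_def vec_eq_iff blinfun.sum_right blinfun.scaleR_right)

lemma winner_Phi_lincomb:
  "winner wt (Phi \<phi> (lincomb h u)) y = (\<Sum>j\<in>UNIV. u $ j * winner wt (Phi \<phi> (h j)) y)"
  unfolding Phi_lincomb winner_def sum_distrib_left
  by (subst sum.swap) (simp add: sum_distrib_left sum_distrib_right mult_ac)

text \<open>The Gram matrix is the matrix of the weighted inner product pulled back along
  \<open>Phi \<phi>\<close> and \<open>lincomb h\<close>. This form, together with its analogue for \<open>data_vector\<close>, lets the
  rest of the proof work with \<open>Phi \<phi>\<close> instead of double sums.\<close>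

lemma gram_matrix_mult_nth:
  "(gram_matrix wt \<phi> h *v u) $ l = winner wt (Phi \<phi> (h l)) (Phi \<phi> (lincomb h u))"
proof -
  have "(gram_matrix wt \<phi> h *v u) $ l = (\<Sum>j\<in>UNIV. u $ j * winner wt (Phi \<phi> (h j)) (Phi \<phi> (h l)))"
    by (simp add: matrix_vector_mult_def gram_matrix_def winner_def Phi_def mult_ac)
  also have "\<dots> = winner wt (Phi \<phi> (lincomb h u)) (Phi \<phi> (h l))"
    by (rule winner_Phi_lincomb[symmetric])
  finally show ?thesis by (simp only: winner_commute)
qed

lemma data_vector_nth: "data_vector wt \<phi> \<xi> h $ l = winner wt (Phi \<phi> (h l)) \<xi>"
  by (simp add: data_vector_def winner_def Phi_def mult_ac)

lemma inner_gram_matrix: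
  "u \<bullet> (gram_matrix wt \<phi> h *v u) = winner wt (Phi \<phi> (lincomb h u)) (Phi \<phi> (lincomb h u))"
  by (simp add: inner_vec_def gram_matrix_mult_nth winner_Phi_lincomb[of wt \<phi> h u])

lemma winner_self_nonneg: "(\<And>i. wt i > 0) \<Longrightarrow> 0 \<le> winner wt x x"
  unfolding winner_def by (intro sum_nonneg) (simp add: less_imp_le mult.assoc)

lemma winner_self_eq_0:
  assumes wt_pos: "\<And>i. wt i > 0" and "winner wt x x = 0"
  shows "x = 0"
proof -
  have "\<And>i. 0 \<le> wt i * x $ i * x $ i"
    using wt_pos by (simp add: less_imp_le mult.assoc)
  then have "\<forall>i. wt i * x $ i * x $ i = 0"
    using assms(2) sum_nonneg_eq_0_iff[of UNIV "\<lambda>i. wt i * x $ i * x $ i"]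
    unfolding winner_def by auto
  then show ?thesis
    using wt_pos by (simp add: vec_eq_iff less_imp_neq[symmetric])
qed

section \<open>Positive definiteness and the normal equation\<close>

lemma span_functionals_kernel:
  fixes S :: "('a::real_normed_vector \<Rightarrow>\<^sub>L real) set"
  assumes "p \<in> span S" and "\<And>q. q \<in> S \<Longrightarrow> blinfun_apply q g = 0"
  shows "blinfun_apply p g = 0"
  using assms(1)
  by (induction rule: span_induct_alt)
    (auto simp: blinfun.add_left blinfun.scaleR_left assms(2))

lemma common_kernel_eq:
  fixes \<phi> :: "'n::finite \<Rightarrow> 'a::real_normed_vector \<Rightarrow>\<^sub>L real"
  assumes psi_span: "span (range \<psi>) = span (range \<phi>)"
  shows "(\<forall>j. blinfun_apply (\<psi> j) g = 0) \<longleftrightarrow> Phi \<phi> g = 0"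
proof -
  have in_span: "\<phi> i \<in> span (range \<psi>)" "\<psi> j \<in> span (range \<phi>)" for i j
    by (auto simp: psi_span intro: span_base) (auto simp: psi_span[symmetric] intro: span_base)
  have "(\<forall>j. blinfun_apply (\<psi> j) g = 0) \<longleftrightarrow> (\<forall>i. blinfun_apply (\<phi> i) g = 0)"
    using span_functionals_kernel[OF in_span(1), of g] span_functionals_kernel[OF in_span(2), of g]
    by blast
  then show ?thesis
    by (simp add: Phi_def vec_eq_iff)
qed

lemma biorth_coefficient:
  assumes biorth: "\<And>i j. blinfun_apply (\<psi> i) (h j) = (if i = j then 1 else 0)"
  shows "blinfun_apply (\<psi> i) (lincomb h u) = u $ i"
  by (simp add: lincomb_def blinfun.sum_right blinfun.scaleR_right biorth if_distrib cong: if_cong)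

text \<open>Positive definiteness is injectivity of \<open>Phi \<phi>\<close> on the span of the \<open>h j\<close>: a vanishing
  image puts the combination into the common kernel of the \<open>\<psi> j\<close>, which read off its
  coefficients.\<close>

lemma gram_matrix_positive_definite:
  fixes \<phi> :: "'n::finite \<Rightarrow> 'a::real_normed_vector \<Rightarrow>\<^sub>L real"
  assumes wt_pos: "\<And>i. wt i > 0"
    and psi_span: "span (range \<psi>) = span (range \<phi>)"
    and biorth: "\<And>i j. blinfun_apply (\<psi> i) (h j) = (if i = j then 1 else 0)"
    and "u \<noteq> 0"
  shows "0 < u \<bullet> (gram_matrix wt \<phi> h *v u)"
proof (rule ccontr)
  assume "\<not> ?thesis"
  then have "Phi \<phi> (lincomb h u) = 0"
    using winner_self_nonneg[of wt "Phi \<phi> (lincomb h u)", OF wt_pos]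
    by (intro winner_self_eq_0[of wt, OF wt_pos]) (simp add: inner_gram_matrix)
  then have "\<forall>j. blinfun_apply (\<psi> j) (lincomb h u) = 0"
    using common_kernel_eq[OF psi_span] by blast
  then show False
    using \<open>u \<noteq> 0\<close> by (simp add: biorth_coefficient[OF biorth] vec_eq_iff)
qed

text \<open>Subtracting from \<open>g\<close> its biorthogonal projection leaves an element of the common kernel, so
  the projection has the same image. Hence \<open>Phi \<phi>\<close> loses nothing when restricted to the span of
  the \<open>h j\<close>, although \<open>g\<close> itself need not lie there.\<close>

lemma Phi_eq_Phi_lincomb:
  fixes \<phi> :: "'n::finite \<Rightarrow> 'a::real_normed_vector \<Rightarrow>\<^sub>L real"
  assumes psi_span: "span (range \<psi>) = span (range \<phi>)"
    and biorth: "\<And>i j. blinfun_apply (\<psi> i) (h j) = (if i = j then 1 else 0)"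
  shows "Phi \<phi> g = Phi \<phi> (lincomb h (\<chi> j. blinfun_apply (\<psi> j) g))"
proof -
  have "Phi \<phi> (g - lincomb h (\<chi> j. blinfun_apply (\<psi> j) g)) = 0"
    unfolding common_kernel_eq[OF psi_span, symmetric]
    by (simp add: blinfun.diff_right biorth_coefficient[OF biorth])
  then show ?thesis
    by (simp add: Phi_def vec_eq_iff blinfun.diff_right)
qed

text \<open>Two functionals in the range of \<open>Phi_adj\<close> agree as soon as they agree on every \<open>h l\<close>,
  because they depend on their argument only through \<open>Phi \<phi>\<close>, whose values are all taken on
  combinations of the \<open>h l\<close>. Their values on \<open>h l\<close> are the
  coordinates of the two sides of the Gram system.\<close>

lemma normal_equation_iff_gram_system:
  fixes \<phi> :: "'n::finite \<Rightarrow> 'a::real_normed_vector \<Rightarrow>\<^sub>L real"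
  assumes psi_span: "span (range \<psi>) = span (range \<phi>)"
    and biorth: "\<And>i j. blinfun_apply (\<psi> i) (h j) = (if i = j then 1 else 0)"
  shows "Phi_adj wt \<phi> (Phi \<phi> (lincomb h u)) = Phi_adj wt \<phi> \<xi>
    \<longleftrightarrow> gram_matrix wt \<phi> h *v u = data_vector wt \<phi> \<xi> h" (is "?normal \<longleftrightarrow> ?gram")
proof
  assume ?normal
  then have "blinfun_apply (Phi_adj wt \<phi> (Phi \<phi> (lincomb h u))) (h l)
      = blinfun_apply (Phi_adj wt \<phi> \<xi>) (h l)" for l
    by simp
  then show ?gram
    by (simp add: vec_eq_iff gram_matrix_mult_nth data_vector_nth blinfun_apply_Phi_adj)
next
  assume ?gram
  then have eq: "winner wt (Phi \<phi> (h l)) (Phi \<phi> (lincomb h u)) = winner wt (Phi \<phi> (h l)) \<xi>" for l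
    by (simp add: vec_eq_iff gram_matrix_mult_nth data_vector_nth)
  have "winner wt (Phi \<phi> g) (Phi \<phi> (lincomb h u)) = winner wt (Phi \<phi> g) \<xi>" for g
    by (subst (1 2) Phi_eq_Phi_lincomb[OF psi_span biorth, where g = g])
      (simp add: winner_Phi_lincomb[of wt \<phi> h "\<chi> j. blinfun_apply (\<psi> j) g"] eq)
  then show ?normal
    by (intro blinfun_eqI) (simp add: blinfun_apply_Phi_adj)
qed

section \<open>Convergence rates\<close>

lemma bigo_at_right_0_of_linear_bound:
  fixes g :: "real \<Rightarrow> real"
  assumes "\<And>lam. lam > 0 \<Longrightarrow> 0 \<le> g lam \<and> g lam \<le> c * lam"
  shows "g \<in> O[at_right 0](\<lambda>lam. lam)"
proof (rule bigoI)
  show "\<forall>\<^sub>F lam in at_right 0. norm (g lam) \<le> c * norm lam"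
    using eventually_at_right_less[of "0::real"]
    by eventually_elim (use assms in simp)
qed

theorem theorem6p1:
  fixes \<phi> :: "'n::finite \<Rightarrow> 'a::real_normed_vector \<Rightarrow>\<^sub>L real"
    and \<xi> :: "real ^ 'n"
    and wt :: "'n \<Rightarrow> real"
    and \<psi> :: "'k::finite \<Rightarrow> 'a \<Rightarrow>\<^sub>L real"
    and h :: "'k \<Rightarrow> 'a"
  assumes wt_pos: "\<And>i. wt i > 0"
    and psi_indep: "inj \<psi>" "independent (range \<psi>)"
    and psi_span: "span (range \<psi>) = span (range \<phi>)"
    and biorth: "\<And>i j. blinfun_apply (\<psi> i) (h j) = (if i = j then 1 else 0)"
  shows
    "(\<exists>!u. gram_matrix wt \<phi> h *v u = data_vector wt \<phi> \<xi> h)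
   \<and> (\<forall>lam>0. \<exists>!u. (gram_matrix wt \<phi> h + lam *\<^sub>R mat 1) *v u = data_vector wt \<phi> \<xi> h)
   \<and> (\<exists>!w. u_dagger wt \<phi> \<xi> h = gram_matrix wt \<phi> h *v w)
   \<and> (\<forall>f. (f \<in> span (range h) \<and> Phi_adj wt \<phi> (Phi \<phi> f) = Phi_adj wt \<phi> \<xi>)
            \<longleftrightarrow> f = f_dagger wt \<phi> \<xi> h)
   \<and> (\<forall>lam>0. norm (u_dagger wt \<phi> \<xi> h - u_reg wt \<phi> \<xi> h lam) \<le> lam * norm (w_source wt \<phi> \<xi> h)
          \<and> norm (f_dagger wt \<phi> \<xi> h - f_reg wt \<phi> \<xi> h lam)
              \<le> sqrt (\<Sum>j\<in>UNIV. (norm (h j))\<^sup>2) * norm (u_dagger wt \<phi> \<xi> h - u_reg wt \<phi> \<xi> h lam))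
   \<and> (\<lambda>lam. norm (u_dagger wt \<phi> \<xi> h - u_reg wt \<phi> \<xi> h lam)) \<in> O[at_right 0](\<lambda>lam. lam)
   \<and> (\<lambda>lam. norm (f_dagger wt \<phi> \<xi> h - f_reg wt \<phi> \<xi> h lam)) \<in> O[at_right 0](\<lambda>lam. lam)"
proof -
  let ?A = "gram_matrix wt \<phi> h"
  let ?v = "data_vector wt \<phi> \<xi> h"
  let ?u = "u_dagger wt \<phi> \<xi> h"
  let ?ur = "u_reg wt \<phi> \<xi> h"
  let ?w = "w_source wt \<phi> \<xi> h"
  let ?C = "sqrt (\<Sum>j\<in>UNIV. (norm (h j))\<^sup>2)"
  note pd = gram_matrix_positive_definite[where wt = wt, OF wt_pos psi_span biorth]
  have psd: "0 \<le> x \<bullet> (?A *v x)" for x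
    using pd[of x] by (cases "x = 0") auto
  have ex1: "\<exists>!u. ?A *v u = b" for b
    by (rule positive_definite_ex1_solution[OF pd])
  have ex1_reg: "\<exists>!u. (?A + lam *\<^sub>R mat 1) *v u = ?v" if "lam > 0" for lam
    by (rule positive_definite_ex1_solution)
      (use that psd in \<open>auto simp: regularized_mult inner_add_right intro!: add_nonneg_pos\<close>)
  have ex1_w: "\<exists>!w. ?u = ?A *v w"
    using ex1[of ?u] by (simp add: eq_commute)
  have u: "?A *v ?u = ?v"
    unfolding u_dagger_def by (rule theI'[OF ex1])
  have ur: "(?A + lam *\<^sub>R mat 1) *v ?ur lam = ?v" if "lam > 0" for lam
    unfolding u_reg_def by (rule theI'[OF ex1_reg[OF that]])
  have w: "?u = ?A *v ?w"
    unfolding w_source_def by (rule theI'[OF ex1_w])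
  have f_dagger: "f_dagger wt \<phi> \<xi> h = lincomb h ?u"
    by (simp add: f_dagger_def lincomb_def)
  have f_reg: "f_reg wt \<phi> \<xi> h lam = lincomb h (?ur lam)" for lam
    by (simp add: f_reg_def lincomb_def)
  note normal = normal_equation_iff_gram_system[OF psi_span biorth]
  have normal_unique: "(f \<in> span (range h) \<and> Phi_adj wt \<phi> (Phi \<phi> f) = Phi_adj wt \<phi> \<xi>)
      \<longleftrightarrow> f = f_dagger wt \<phi> \<xi> h" for f
  proof -
    have "?A *v u = ?v \<longleftrightarrow> u = ?u" for u
      using ex1[of ?v] u by blast
    then have coeff: "Phi_adj wt \<phi> (Phi \<phi> (lincomb h u)) = Phi_adj wt \<phi> \<xi> \<longleftrightarrow> u = ?u" for u
      unfolding normal .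
    show ?thesis
      unfolding span_range_eq_lincomb f_dagger by (auto simp: coeff)
  qed
  have u_bound: "norm (?u - ?ur lam) \<le> lam * norm ?w" if "lam > 0" for lam
    using norm_regularization_error_le[OF psd that, of "?ur lam" ?w] ur[OF that] u
    unfolding w[symmetric] by simp
  have f_bound: "norm (f_dagger wt \<phi> \<xi> h - f_reg wt \<phi> \<xi> h lam) \<le> ?C * norm (?u - ?ur lam)" for lam
    unfolding f_dagger f_reg lincomb_diff[symmetric] by (rule norm_lincomb_le)
  have f_linear_bound:
    "norm (f_dagger wt \<phi> \<xi> h - f_reg wt \<phi> \<xi> h lam) \<le> (?C * norm ?w) * lam" if "lam > 0" for lam
  proof -
    have "?C * norm (?u - ?ur lam) \<le> ?C * (lam * norm ?w)"
      by (intro mult_left_mono u_bound that real_sqrt_ge_zero sum_nonneg zero_le_power2)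
    then show ?thesis
      using f_bound[of lam] by (simp add: mult_ac)
  qed
  have u_bigo: "(\<lambda>lam. norm (?u - ?ur lam)) \<in> O[at_right 0](\<lambda>lam. lam)"
    using u_bound by (intro bigo_at_right_0_of_linear_bound[where c = "norm ?w"]) (simp add: mult.commute)
  have f_bigo: "(\<lambda>lam. norm (f_dagger wt \<phi> \<xi> h - f_reg wt \<phi> \<xi> h lam)) \<in> O[at_right 0](\<lambda>lam. lam)"
    using f_linear_bound by (intro bigo_at_right_0_of_linear_bound[where c = "?C * norm ?w"]) simp
  show ?thesis
    by (intro conjI allI impI ex1 ex1_reg ex1_w normal_unique u_bound f_bound u_bigo f_bigo)
qed

end
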